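(* Let $s>0$ and let $S=S^*\in\mathbb{C}^{2\times 2}$ be a self-adjoint matrix with $S_{1,1},S_{2,2}\in\mathbb{R}$ and $S_{1,2}=\overline{S_{2,1}}=is$. Define $F_0\colon\mathbb{R}\to\mathbb{C}^{2\times2}$ by $F_0(x)=ixS$, $x\in\mathbb{R}$. Then for all $N\in\mathbb{N}$ and all $x_p\in\mathbb{R}$, $1\le p\le N$, the block matrix $\{F_0(x_p-x_q)-F_0(x_p)-F_0(x_q)^*\}_{1\le p,q\le N}\in\mathbb{C}^{2N\times 2N}$ is positive semidefinite, but $F_0$ is not conditionally positive semidefinite.
   Context: A matrix $A\in\mathbb{C}^{M\times M}$ is positive semidefinite if $\sum_{j,k=1}^M\overline{c_j}A_{j,k}c_k\ge 0$ for all $c\in\mathbb{C}^M$. A self-adjoint matrix $A=A^*\in\mathbb{C}^{M\times M}$ is conditionally positive semidefinite if $\sum_{j,k=1}^M\overline{c_j}A_{j,k}c_k\ge 0$ for all $c\in\mathbb{C}^M$ with $\sum_{j=1}^M c_j=0$ (self-adjointness is part of the definition). A function $F\colon\mathbb{R}^n\to\mathbb{C}^{m\times m}$ is conditionally positive semidefinite if for all $N\in\mathbb{N}$ and $x_1,\dots,x_N\in\mathbb{R}^n$ the block matrix $\{F(x_p-x_q)\}_{1\le p,q\le N}\in\mathbb{C}^{mN\times mN}$ is conditionally positive semidefinite. Here $n=1$, $m=2$. *)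

theory Defs
  imports "HOL-Analysis.Euclidean_Space" "Jordan_Normal_Form.Schur_Decomposition"
begin

(* The order on complex is the one of Complex_Order: 0 \<le> z means that z is real and nonnegative. *)

definition psd :: "complex mat \<Rightarrow> bool" where
  "psd A \<longleftrightarrow> square_mat A \<and>
    (\<forall>c \<in> carrier_vec (dim_row A).
      0 \<le> (\<Sum>j<dim_row A. \<Sum>k<dim_row A. cnj (c $ j) * A $$ (j, k) * c $ k))"

(* mat_adjoint is the conjugate transpose, so the first conjunct also makes A square. *)

definition cond_psd :: "complex mat \<Rightarrow> bool" where
  "cond_psd A \<longleftrightarrow> mat_adjoint A = A \<and>
    (\<forall>c \<in> carrier_vec (dim_row A).
      (\<Sum>j<dim_row A. c $ j) = 0 \<longrightarrow>
      0 \<le> (\<Sum>j<dim_row A. \<Sum>k<dim_row A. cnj (c $ j) * A $$ (j, k) * c $ k))"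

(* B p q, for p, q < N, is the m x m block in block row p and block column q (counted from 0). *)

definition block_mat :: "nat \<Rightarrow> nat \<Rightarrow> (nat \<Rightarrow> nat \<Rightarrow> complex mat) \<Rightarrow> complex mat" where
  "block_mat m N B =
    mat (m * N) (m * N) (\<lambda>(j, k). B (j div m) (k div m) $$ (j mod m, k mod m))"

(* To be used for functions F with values in carrier_mat m m. The points are
   x 0, ..., x (N - 1); N = 0 gives the empty matrix, for which the condition is vacuous. *)

definition cond_psd_fun :: "nat \<Rightarrow> ('a::euclidean_space \<Rightarrow> complex mat) \<Rightarrow> bool" where
  "cond_psd_fun m F \<longleftrightarrow>
    (\<forall>(N::nat) (x::nat \<Rightarrow> 'a). cond_psd (block_mat m N (\<lambda>p q. F (x p - x q))))"

end

(* Since S is self-adjoint, F\<^sub>0 is additive with F\<^sub>0 x adjoint to F\<^sub>0 (- x), so the first block matrix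
   vanishes. For F\<^sub>0 itself the quadratic form at vectors c\<^sub>p is - 2 Im (a* S b) with
   a = \<Sum> x\<^sub>p c\<^sub>p and b = \<Sum> c\<^sub>p, where only the sum of the two entries of b has to vanish.
   Taking b = (1, -1) and a = (-1, 0) makes it equal to - 2 s. *)
theory Submission
  imports Defs
begin

lemma mat_adjoint_smult:
  "mat_adjoint (a \<cdot>\<^sub>m A) = conjugate a \<cdot>\<^sub>m mat_adjoint A" for A :: "'a::conjugatable_field mat"
  by (rule eq_matI) (auto simp: mat_adjoint_def mat_of_rows_def conjugate_dist_mul)

theorem mainTheorem2:
  fixes s :: real and S :: "complex mat" and F\<^sub>0 :: "real \<Rightarrow> complex mat"
  assumes "s > 0"
    and "S \<in> carrier_mat 2 2"
    and "mat_adjoint S = S"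
    and "S $$ (0, 0) \<in> \<real>" and "S $$ (1, 1) \<in> \<real>"
    and "S $$ (0, 1) = cnj (S $$ (1, 0))" and "S $$ (0, 1) = \<i> * complex_of_real s"
    and "\<And>x. F\<^sub>0 x = (\<i> * complex_of_real x) \<cdot>\<^sub>m S"
  shows "(\<forall>(N::nat) (x::nat \<Rightarrow> real).
            psd (block_mat 2 N (\<lambda>p q. F\<^sub>0 (x p - x q) - F\<^sub>0 (x p) - mat_adjoint (F\<^sub>0 (x q)))))
         \<and> \<not> cond_psd_fun 2 F\<^sub>0"
proof (intro conjI allI)
  fix N :: nat and x :: "nat \<Rightarrow> real"
  have zero: "F\<^sub>0 (x p - x q) - F\<^sub>0 (x p) - mat_adjoint (F\<^sub>0 (x q)) = 0\<^sub>m 2 2" for p q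
    \<comment> \<open>Conjugating the scalar turns the last adjoint into \<open>- \<i> * x q\<close>
      times \<open>S\<close>, so the coefficients of \<open>S\<close> cancel.\<close>
    unfolding assms(8) mat_adjoint_smult assms(3)
    by (rule eq_matI) (use assms(2) in \<open>auto simp: algebra_simps\<close>)
  show "psd (block_mat 2 N (\<lambda>p q. F\<^sub>0 (x p - x q) - F\<^sub>0 (x p) - mat_adjoint (F\<^sub>0 (x q))))"
    unfolding zero by (simp add: psd_def block_mat_def)
next
  \<comment> \<open>The two points are 0 and 1, so the vector a of the overview is just the second
    block of \<open>c\<close>.\<close>
  define A where "A = block_mat 2 2 (\<lambda>p q. F\<^sub>0 (real p - real q))"
  \<comment> \<open>The blocks are (2, -1) and (-1, 0): the second is a, and the first is b -
    a.\<close>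
  define c where "c = vec 4 (\<lambda>j. [2, -1, -1, 0 :: complex] ! j)"
  have dim: "dim_row A = 4"
    by (simp add: A_def block_mat_def)
  have S10: "S $$ (1, 0) = - \<i> * complex_of_real s"
    using assms(6,7) by (metis complex_cnj_cnj complex_cnj_complex_of_real complex_cnj_i complex_cnj_mult)
  have sum4: "(\<Sum>j<4. f j) = f 0 + f 1 + f 2 + f 3" for f :: "nat \<Rightarrow> complex"
    by (simp add: lessThan_nat_numeral lessThan_Suc)
  have c: "c \<in> carrier_vec 4" "(\<Sum>j<4. c $ j) = 0"
    by (simp_all add: c_def sum4)
  \<comment> \<open>Only the off-diagonal blocks \<open>- \<i> * S\<close> and
    \<open>\<i> * S\<close> contribute. Their \<open>S $$ (0, 0)\<close> terms cancel, while
    \<open>S $$ (0, 1)\<close> and \<open>S $$ (1, 0)\<close> give - s each.\<close>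
  have form: "(\<Sum>j<4. \<Sum>k<4. cnj (c $ j) * A $$ (j, k) * c $ k) = - 2 * complex_of_real s"
    using assms(2,7) S10
    by (simp add: A_def block_mat_def c_def assms(8) sum4 algebra_simps flip: One_nat_def)
  have "\<not> cond_psd A"
  proof
    assume "cond_psd A"
    then have "0 \<le> (\<Sum>j<4. \<Sum>k<4. cnj (c $ j) * A $$ (j, k) * c $ k)"
      using c unfolding cond_psd_def dim by blast
    then show False
      using assms(1) unfolding form by (simp add: less_eq_complex_def)
  qed
  then show "\<not> cond_psd_fun 2 F\<^sub>0"
    unfolding cond_psd_fun_def A_def by blast
qed

end
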